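(* For the Petersen graph $\mathcal{P}$, $\dim_f^k(\mathcal{P})=k\dim_f(\mathcal{P})=\frac53k$ for every real $k\in[1,6]$.
   Context: For a finite simple connected graph $G$ with at least two vertices, $d(x,y)$ is the length of a shortest path between $x$ and $y$. For distinct $x,y\in V(G)$, let $R\{x,y\}=\{z\in V(G): d(x,z)\neq d(y,z)\}$, and let $\kappa(G)=\min\{|R\{x,y\}|: x\neq y,\ x,y\in V(G)\}$. For a function $g$ on $V(G)$ and $U\subseteq V(G)$, write $g(U)=\sum_{s\in U}g(s)$. For a real number $k\in[1,\kappa(G)]$, a function $g:V(G)\to[0,1]$ is a $k$-resolving function of $G$ if $g(R\{x,y\})\ge k$ for any two distinct vertices $x,y\in V(G)$; the fractional $k$-metric dimension is $\dim_f^k(G)=\min\{g(V(G)): g \text{ is a } k\text{-resolving function of } G\}$. The fractional metric dimension is $\dim_f(G)=\dim_f^1(G)$. *)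

theory Defs
  imports Complex_Main "Graph_Theory.Digraph_Component"
begin

text \<open>
  A finite simple graph is an \<^term>\<open>G :: 'a pair_pre_digraph\<close> satisfying \<^locale>\<open>pair_graph\<close>: each
  undirected edge \<open>uv\<close> is represented by the two arcs \<open>(u, v)\<close> and \<open>(v, u)\<close>. The notions below are
  meaningful for graphs that are moreover connected and have at least two vertices.
\<close>

definition gdist :: "'a pair_pre_digraph \<Rightarrow> 'a \<Rightarrow> 'a \<Rightarrow> nat" where
  "gdist G x y = (LEAST n. \<exists>p. pre_digraph.apath (with_proj G) x p y \<and> length p = n)"

definition resolving_set :: "'a pair_pre_digraph \<Rightarrow> 'a \<Rightarrow> 'a \<Rightarrow> 'a set" where
  "resolving_set G x y = {z \<in> pverts G. gdist G x z \<noteq> gdist G y z}"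

definition kappa :: "'a pair_pre_digraph \<Rightarrow> nat" where
  "kappa G = Min {card (resolving_set G x y) | x y. x \<in> pverts G \<and> y \<in> pverts G \<and> x \<noteq> y}"

text \<open>
  The admissible range \<open>1 \<le> k \<le> kappa G\<close> is part of the notion. Functions on the vertex set
  are total functions whose values outside \<^term>\<open>pverts G\<close> are irrelevant.
\<close>

definition resolving_function :: "'a pair_pre_digraph \<Rightarrow> real \<Rightarrow> ('a \<Rightarrow> real) \<Rightarrow> bool" where
  "resolving_function G k g \<longleftrightarrow>
     1 \<le> k \<and> k \<le> real (kappa G) \<and>
     (\<forall>v \<in> pverts G. 0 \<le> g v \<and> g v \<le> 1) \<and>
     (\<forall>x \<in> pverts G. \<forall>y \<in> pverts G. x \<noteq> y \<longrightarrow> sum g (resolving_set G x y) \<ge> k)"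

text \<open>
  \<open>LEAST\<close> on the reals denotes an attained minimum (it is unspecified if there is none), in
  contrast to \<open>Inf\<close>.
\<close>

definition frac_k_metric_dim :: "'a pair_pre_digraph \<Rightarrow> real \<Rightarrow> real" where
  "frac_k_metric_dim G k = (LEAST w. \<exists>g. resolving_function G k g \<and> w = sum g (pverts G))"

definition frac_metric_dim :: "'a pair_pre_digraph \<Rightarrow> real" where
  "frac_metric_dim G = frac_k_metric_dim G 1"

text \<open>
  The Petersen graph as the Kneser graph \<open>K(5, 2)\<close>: the vertices are the two-element subsets of a
  five-element set, adjacent iff disjoint.
\<close>

definition petersen :: "nat set pair_pre_digraph" where
  "petersen =
     (let V = {A. A \<subseteq> {0..<5} \<and> card A = 2}
      in \<lparr> pverts = V, parcs = {(A, B). A \<in> V \<and> B \<in> V \<and> A \<inter> B = {}} \<rparr>)"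

lemma pair_graph_petersen: "pair_graph petersen"
proof -
  have fin: "finite (pverts petersen)"
    by (rule finite_subset[of _ "Pow {0..<5}"]) (auto simp: petersen_def Let_def)
  have sub: "parcs petersen \<subseteq> pverts petersen \<times> pverts petersen"
    by (auto simp: petersen_def Let_def)
  show ?thesis
  proof unfold_locales
    show "finite (parcs petersen)"
      using fin sub by (meson finite_SigmaI finite_subset)
    show "symmetric (with_proj petersen)"
      by (auto simp: symmetric_def petersen_def Let_def intro!: symI)
  qed (use fin in \<open>auto simp: petersen_def Let_def\<close>)
qed

lemma card_pverts_petersen: "card (pverts petersen) = 10"
  using n_subsets[of "{0..<5::nat}" 2]
  by (simp add: petersen_def Let_def choose_two)

lemma connected_petersen: "connected (with_proj petersen)"
proof -
  interpret pair_graph petersen by (rule pair_graph_petersen)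
  have arcD: "A \<rightarrow>\<^sup>*\<^bsub>with_proj petersen\<^esub> B"
    if "A \<in> pverts petersen" "B \<in> pverts petersen" "A \<inter> B = {}" for A B
    using that by (intro reachable_adjI) (auto simp: petersen_def Let_def)
  have "A \<rightarrow>\<^sup>*\<^bsub>with_proj petersen\<^esub> B" if A: "A \<in> pverts petersen" and B: "B \<in> pverts petersen" for A B
  proof -
    consider "A \<inter> B = {}" | "A \<inter> B \<noteq> {}" by blast
    then show ?thesis
    proof cases
      case 1
      then show ?thesis using arcD A B by blast
    next
      case 2
      have AB: "A \<subseteq> {0..<5}" "B \<subseteq> {0..<5}" "card A = 2" "card B = 2"
        using A B by (auto simp: petersen_def Let_def)
      then have fin: "finite A" "finite B" by (auto intro: finite_subset)
      have "card (A \<inter> B) > 0" using 2 fin by (simp add: card_gt_0_iff)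
      then have "card (A \<union> B) \<le> 3" using card_Un_Int[OF fin] AB by linarith
      then have "2 \<le> card ({0..<5} - (A \<union> B))"
        using AB fin by (subst card_Diff_subset) auto
      then obtain C where C: "C \<subseteq> {0..<5} - (A \<union> B)" "card C = 2"
        by (meson obtain_subset_with_card_n)
      then have "C \<in> pverts petersen" by (auto simp: petersen_def Let_def)
      then have "A \<rightarrow>\<^sup>*\<^bsub>with_proj petersen\<^esub> C" "C \<rightarrow>\<^sup>*\<^bsub>with_proj petersen\<^esub> B"
        using arcD A B C by blast+
      then show ?thesis by (rule reachable_trans)
    qed
  qed
  moreover have "pverts petersen \<noteq> {}" using card_pverts_petersen by auto
  ultimately have "strongly_connected (with_proj petersen)"
    by (auto simp: strongly_connected_def)
  then show ?thesis by (auto simp: connected_def strongly_connected_def intro: reachable_mk_symmetricI)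
qed

end

theory Submission
  imports Defs
begin

text \<open>
  The Petersen graph is strongly regular: it is 3-regular, adjacent vertices have no common neighbour
  and distinct non-adjacent ones have exactly one. Since its diameter is 2, every resolving set has
  6 elements; so the constant function \<open>k / 6\<close> is \<open>k\<close>-resolving, with total weight \<open>5 k / 3\<close>.
  Conversely, for an edge \<open>xy\<close> the resolving set is the disjoint union of the two neighbourhoods, and
  summing the 30 inequalities \<open>g(N(x)) + g(N(y)) \<ge> k\<close> over all arcs counts every vertex 18 times.
\<close>

lemma (in pair_graph) gdist_self:
  assumes "x \<in> pverts G"
  shows "gdist G x x = 0"
  unfolding gdist_def
  by (rule Least_eq_0) (use assms in \<open>auto simp: apath_Nil_iff\<close>)

lemma (in pair_graph) gdist_adjacent:
  assumes "(x, y) \<in> parcs G"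
  shows "gdist G x y = 1"
proof -
  have "x \<noteq> y" "x \<in> pverts G" "y \<in> pverts G"
    using assms no_loops[of "(x, y)"] in_arcsD1[OF assms] in_arcsD2[OF assms] by auto
  moreover from this have "apath x [(x, y)] y"
    using assms by (simp add: apath_Cons_iff apath_Nil_iff)
  ultimately show ?thesis
    unfolding gdist_def
    by (intro Least_equality) (auto intro!: exI[of _ "[(x, y)]"] simp: apath_Nil_iff Suc_le_eq)
qed

lemma (in pair_graph) gdist_common_neighbour:
  assumes "x \<noteq> y" "(x, y) \<notin> parcs G" "(x, z) \<in> parcs G" "(z, y) \<in> parcs G"
  shows "gdist G x y = 2"
proof -
  have neq: "x \<noteq> z" "z \<noteq> y" using assms no_loops by force+
  have "x \<in> pverts G" "z \<in> pverts G" "y \<in> pverts G"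
    using assms in_arcsD1 in_arcsD2 by blast+
  then have path: "apath x [(x, z), (z, y)] y"
    using assms neq by (auto simp: apath_Cons_iff apath_Nil_iff)
  \<comment> \<open>A shorter path is empty, forcing \<open>x = y\<close>, or consists of the single
    arc \<open>(x, y)\<close>; both are excluded.\<close>
  have "2 \<le> length p" if p: "apath x p y" for p
  proof (rule ccontr)
    assume "\<not> 2 \<le> length p"
    then consider "p = []" | e where "p = [e]"
      by (cases p; cases "tl p") auto
    then show False
      using p assms by cases (auto simp: apath_Cons_iff apath_Nil_iff)
  qed
  with path show ?thesis
    unfolding gdist_def
    by (intro Least_equality) (auto intro!: exI[of _ "[(x, z), (z, y)]"])
qed

definition nbrs :: "nat set \<Rightarrow> nat set set" where
  "nbrs x = {z \<in> pverts petersen. x \<inter> z = {}}"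

lemma in_pverts_petersen: "x \<in> pverts petersen \<longleftrightarrow> x \<subseteq> {0..<5} \<and> card x = 2"
  by (simp add: petersen_def Let_def)

lemma finite_pverts_petersen: "finite (pverts petersen)"
  using card_pverts_petersen card.infinite by force

lemma finite_vertex: "x \<in> pverts petersen \<Longrightarrow> finite x"
  by (auto simp: in_pverts_petersen intro: finite_subset)

lemma in_parcs_petersen: "(x, y) \<in> parcs petersen \<longleftrightarrow> x \<in> pverts petersen \<and> y \<in> nbrs x"
  by (auto simp: petersen_def Let_def nbrs_def)

lemma finite_nbrs: "finite (nbrs x)"
  by (simp add: nbrs_def finite_pverts_petersen)

lemma nbrs_sym:
  assumes "x \<in> pverts petersen" "y \<in> pverts petersen"
  shows "x \<in> nbrs y \<longleftrightarrow> y \<in> nbrs x"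
  using assms by (auto simp: nbrs_def)

lemma not_in_nbrs_self: "x \<notin> nbrs x"
  by (auto simp: nbrs_def in_pverts_petersen)

text \<open>These vertices are the 2-subsets of the complement of \<open>S\<close>. Taking
  \<open>S = x\<close> yields the degree, taking \<open>S = x \<union> y\<close> the number of
  common neighbours.\<close>

lemma card_disjoint_vertices:
  assumes "S \<subseteq> {0..<5}"
  shows "card {z \<in> pverts petersen. S \<inter> z = {}} = (5 - card S) choose 2"
proof -
  have "{z \<in> pverts petersen. S \<inter> z = {}} = {z. z \<subseteq> {0..<5} - S \<and> card z = 2}"
    by (auto simp: in_pverts_petersen)
  then show ?thesis
    using assms by (simp add: n_subsets card_Diff_subset finite_subset)
qed

lemma card_nbrs:
  assumes "x \<in> pverts petersen"
  shows "card (nbrs x) = 3"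
  using assms card_disjoint_vertices[of x]
  by (simp add: nbrs_def in_pverts_petersen choose_two)

text \<open>A common neighbour is a 2-subset of the complement of \<open>x \<union> y\<close>. That
  complement has one element if \<open>x\<close> and \<open>y\<close> are disjoint, and two if they
  meet.\<close>

lemma card_common_nbrs:
  assumes "x \<in> pverts petersen" "y \<in> pverts petersen" "x \<noteq> y"
  shows "card (nbrs x \<inter> nbrs y) = (if y \<in> nbrs x then 0 else 1)"
proof -
  have fin: "finite x" "finite y" using assms finite_vertex by auto
  have xy: "card x = 2" "card y = 2" "x \<union> y \<subseteq> {0..<5}"
    using assms by (auto simp: in_pverts_petersen)
  have "nbrs x \<inter> nbrs y = {z \<in> pverts petersen. (x \<union> y) \<inter> z = {}}"
    by (auto simp: nbrs_def)
  then have eq: "card (nbrs x \<inter> nbrs y) = (5 - card (x \<union> y)) choose 2"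
    using card_disjoint_vertices[OF xy(3)] by simp
  have un: "card (x \<union> y) + card (x \<inter> y) = 4"
    using card_Un_Int[OF fin] xy by simp
  show ?thesis
  proof (cases "y \<in> nbrs x")
    case True
    then have "card (x \<union> y) = 4" using un by (simp add: nbrs_def)
    then show ?thesis using eq True by simp
  next
    case False
    then have "card (x \<inter> y) > 0" using assms fin by (auto simp: nbrs_def card_gt_0_iff)
    \<comment> \<open>Distinct sets of equal finite size cannot contain one another, so the
      intersection is a single point.\<close>
    moreover have "card (x \<inter> y) < card x"
    proof (rule psubset_card_mono[OF fin(1)])
      have "x \<inter> y \<noteq> x"
        using assms(3) xy card_subset_eq[OF fin(2), of x] by auto
      then show "x \<inter> y \<subset> x" by auto
    qed
    ultimately have "card (x \<union> y) = 3" using un xy by linarith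
    then show ?thesis using eq False by (simp add: choose_two)
  qed
qed

text \<open>The diameter is 2 because distinct non-adjacent vertices have a common
  neighbour.\<close>

lemma gdist_petersen:
  assumes "x \<in> pverts petersen" "y \<in> pverts petersen"
  shows "gdist petersen x y = (if x = y then 0 else if y \<in> nbrs x then 1 else 2)"
proof -
  interpret pair_graph petersen by (rule pair_graph_petersen)
  show ?thesis
  proof (cases "x = y \<or> y \<in> nbrs x")
    case True
    then show ?thesis
      using assms gdist_self[of x] gdist_adjacent[of x y] not_in_nbrs_self[of x]
      by (auto simp: in_parcs_petersen)
  next
    case False
    then have "card (nbrs x \<inter> nbrs y) = 1" using card_common_nbrs assms by auto
    then obtain z where z: "z \<in> nbrs x" "z \<in> nbrs y"
      by (metis IntE card_1_singletonE insertI1)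
    then have "z \<in> pverts petersen" by (simp add: nbrs_def)
    then show ?thesis
      using False assms z gdist_common_neighbour[of x y z] nbrs_sym
      by (auto simp: in_parcs_petersen)
  qed
qed

text \<open>A vertex other than \<open>x\<close> and \<open>y\<close> has distance 1 or 2 from each,
  so it separates them iff it is adjacent to exactly one. Each of \<open>x\<close> and
  \<open>y\<close> is at distance 0 from itself only.\<close>

lemma resolving_set_petersen:
  assumes "x \<in> pverts petersen" "y \<in> pverts petersen" "x \<noteq> y"
  shows "resolving_set petersen x y = {x, y} \<union> ((nbrs x \<union> nbrs y) - (nbrs x \<inter> nbrs y))"
  using assms by (auto simp: resolving_set_def gdist_petersen nbrs_def split: if_splits)

text \<open>There are no triangles, so nothing is removed from the union, and \<open>x\<close> and
  \<open>y\<close> already lie in each other's neighbourhoods.\<close>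

lemma resolving_set_petersen_adjacent:
  assumes "x \<in> pverts petersen" "y \<in> nbrs x"
  shows "resolving_set petersen x y = nbrs x \<union> nbrs y" "nbrs x \<inter> nbrs y = {}"
proof -
  have y: "y \<in> pverts petersen" "x \<noteq> y" "x \<in> nbrs y"
    using assms not_in_nbrs_self by (auto simp: nbrs_def)
  show disj: "nbrs x \<inter> nbrs y = {}"
    using card_common_nbrs[OF assms(1) y(1,2)] assms(2) finite_nbrs by simp
  show "resolving_set petersen x y = nbrs x \<union> nbrs y"
    using resolving_set_petersen[OF assms(1) y(1,2)] disj y(3) assms(2) by auto
qed

lemma card_resolving_set_petersen:
  assumes "x \<in> pverts petersen" "y \<in> pverts petersen" "x \<noteq> y"
  shows "card (resolving_set petersen x y) = 6"
proof (cases "y \<in> nbrs x")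
  case True
  then show ?thesis
    using assms resolving_set_petersen_adjacent[of x y]
    by (simp add: card_Un_disjoint finite_nbrs card_nbrs)
next
  case False
  let ?D = "(nbrs x \<union> nbrs y) - (nbrs x \<inter> nbrs y)"
  \<comment> \<open>Inclusion-exclusion with one common neighbour: 3 + 3 - 1. Deleting that
    neighbour leaves 4, and \<open>x\<close>, \<open>y\<close> themselves bring the count to
    6.\<close>
  have "card (nbrs x \<union> nbrs y) = 5"
    using card_Un_Int[OF finite_nbrs finite_nbrs, of x y] card_common_nbrs[OF assms] False assms
    by (simp add: card_nbrs)
  then have "card ?D = 4"
    using card_common_nbrs[OF assms] False finite_nbrs by (subst card_Diff_subset) auto
  moreover have "{x, y} \<inter> ?D = {}"
    using False assms not_in_nbrs_self nbrs_sym by auto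
  ultimately show ?thesis
    using assms finite_nbrs by (simp add: resolving_set_petersen card_Un_disjoint)
qed

lemma kappa_petersen: "kappa petersen = 6"
proof -
  \<comment> \<open>A concrete pair of distinct vertices shows that the set of cardinalities is
    \<open>{6}\<close> and not empty.\<close>
  have "{0, 1} \<in> pverts petersen" "{0, 2} \<in> pverts petersen" "{0, 1} \<noteq> {0, 2::nat}"
    by (auto simp: in_pverts_petersen doubleton_eq_iff)
  then have "{card (resolving_set petersen x y) | x y.
      x \<in> pverts petersen \<and> y \<in> pverts petersen \<and> x \<noteq> y} = {6}"
    using card_resolving_set_petersen by (auto, metis+)
  then show ?thesis by (simp add: kappa_def)
qed

text \<open>Double counting: exchanging the sums, each \<open>f y\<close> occurs once for each of
  the three neighbours of \<open>y\<close>.\<close>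

lemma sum_nbrs_petersen:
  fixes f :: "nat set \<Rightarrow> real"
  shows "(\<Sum>x \<in> pverts petersen. sum f (nbrs x)) = 3 * sum f (pverts petersen)"
proof -
  have "(\<Sum>x \<in> pverts petersen. sum f (nbrs x))
      = (\<Sum>y \<in> pverts petersen. \<Sum>x | x \<in> pverts petersen \<and> x \<inter> y = {}. f y)"
    unfolding nbrs_def by (rule sum.swap_restrict) (rule finite_pverts_petersen)+
  also have "\<dots> = (\<Sum>y \<in> pverts petersen. \<Sum>x \<in> nbrs y. f y)"
    by (intro sum.cong) (auto simp: nbrs_def)
  finally show ?thesis by (simp add: card_nbrs sum_distrib_left)
qed

lemma resolving_function_petersen_ge:
  assumes "resolving_function petersen k g"
  shows "5 / 3 * k \<le> sum g (pverts petersen)"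
proof -
  let ?V = "pverts petersen"
  have ge: "k \<le> sum g (nbrs x) + sum g (nbrs y)" if x: "x \<in> ?V" and y: "y \<in> nbrs x" for x y
  proof -
    have "y \<in> ?V" "x \<noteq> y" using x y not_in_nbrs_self by (auto simp: nbrs_def)
    then have "k \<le> sum g (resolving_set petersen x y)"
      using assms x by (simp add: resolving_function_def)
    then show ?thesis
      using resolving_set_petersen_adjacent[OF x y] by (simp add: sum.union_disjoint finite_nbrs)
  qed
  have "30 * k = (\<Sum>x \<in> ?V. \<Sum>y \<in> nbrs x. k)"
    by (simp add: card_nbrs card_pverts_petersen)
  also have "\<dots> \<le> (\<Sum>x \<in> ?V. \<Sum>y \<in> nbrs x. sum g (nbrs x) + sum g (nbrs y))"
    using ge by (intro sum_mono) auto
  also have "\<dots> = (\<Sum>x \<in> ?V. 3 * sum g (nbrs x)) + (\<Sum>x \<in> ?V. \<Sum>y \<in> nbrs x. sum g (nbrs y))"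
    by (simp add: sum.distrib card_nbrs)
  \<comment> \<open>Each summand equals \<open>9 * sum g ?V\<close>: the first by one use of
    \<open>sum_nbrs_petersen\<close>, the second by two, the outer one with \<open>f\<close> the
    neighbourhood sum of \<open>g\<close>.\<close>
  also have "\<dots> = 18 * sum g ?V"
    by (simp add: sum_nbrs_petersen flip: sum_distrib_left)
  finally show ?thesis by simp
qed

lemma frac_k_metric_dim_petersen:
  assumes "1 \<le> k" "k \<le> 6"
  shows "frac_k_metric_dim petersen k = 5 / 3 * k"
  unfolding frac_k_metric_dim_def
proof (rule Least_equality)
  \<comment> \<open>Every resolving set has 6 elements, so its weight is exactly \<open>k\<close>;
    the bound \<open>k \<le> 6\<close> keeps the values at most 1.\<close>
  have "resolving_function petersen k (\<lambda>_. k / 6)"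
    using assms by (simp add: resolving_function_def kappa_petersen card_resolving_set_petersen)
  moreover have "5 / 3 * k = sum (\<lambda>_. k / 6) (pverts petersen)"
    by (simp add: card_pverts_petersen)
  ultimately show "\<exists>g. resolving_function petersen k g \<and> 5 / 3 * k = sum g (pverts petersen)"
    by blast
qed (use resolving_function_petersen_ge in blast)

theorem proposition4p10:
  fixes k :: real
  assumes "1 \<le> k" and "k \<le> 6"
  shows "frac_k_metric_dim petersen k = k * frac_metric_dim petersen
       \<and> k * frac_metric_dim petersen = 5 / 3 * k"
  \<comment> \<open>The formula is used both at \<open>k\<close> and at 1, where it gives
    5/3.\<close>
  using assms by (simp add: frac_metric_dim_def frac_k_metric_dim_petersen)

end
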